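(* Let $k$ be any field, let $\mathcal W_n$ be $S_n$, $B_n$ or $D_n$, and let $V$ be a finitely generated $\mathrm{FI}_{\mathcal W}$-module over $k$. Then there exists an integer-valued polynomial $P(T)\in\mathbb Q[T]$ such that $$\dim_k(V_n)=P(n)\qquad\text{for all } n \text{ sufficiently large.}$$
   Context: $B_n$ is the group of signed permutations of $\mathbf n=\{\pm1,\dots,\pm n\}$ (bijections $w$ with $w(-a)=-w(a)$), $D_n\subseteq B_n$ the subgroup of elements reversing an even number of signs, $S_n\subseteq D_n$ the subgroup preserving signs. $\mathrm{FI}_{BC}$ has objects $\mathbf n$, $n\ge0$ ($\mathbf 0=\varnothing$), and morphisms the injections $f:\mathbf m\to\mathbf n$ with $f(-a)=-f(a)$. $\mathrm{FI}_D$ (resp. $\mathrm{FI}_A$) is the subcategory with the same objects in which morphisms with $m=n$ must reverse an even number of signs (resp. all morphisms preserve signs). $\mathrm{FI}_{\mathcal W}$ is $\mathrm{FI}_A,\mathrm{FI}_{BC},\mathrm{FI}_D$ for $\mathcal W_n=S_n,B_n,D_n$. An $\mathrm{FI}_{\mathcal W}$-module over $k$ is a functor $V:\mathrm{FI}_{\mathcal W}\to k$-Mod, $V_n:=V(\mathbf n)$; it is finitely generated if a finite subset of $\coprod_nV_n$ is contained in no proper sub-$\mathrm{FI}_{\mathcal W}$-module. *)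

theory Defs
  imports Complex_Main "HOL-Library.FuncSet" "HOL-Computational_Algebra.Polynomial"
begin

definition signed_set :: "nat \<Rightarrow> int set" where
  "signed_set n = {a. 1 \<le> \<bar>a\<bar> \<and> \<bar>a\<bar> \<le> int n}"

datatype weyl_type = Type_A | Type_BC | Type_D

text \<open>
  Morphisms are extensional functions (\<open>undefined\<close> outside the source), so that equality of
  morphisms is equality of HOL functions. For \<open>m = n\<close> the sets below are the groups
  \<open>S_n\<close>, \<open>B_n\<close>, \<open>D_n\<close>, respectively.
\<close>

definition FI_BC_hom :: "nat \<Rightarrow> nat \<Rightarrow> (int \<Rightarrow> int) set" where
  "FI_BC_hom m n = {f \<in> signed_set m \<rightarrow>\<^sub>E signed_set n.
     inj_on f (signed_set m) \<and> (\<forall>a\<in>signed_set m. f (- a) = - f a)}"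

definition FI_A_hom :: "nat \<Rightarrow> nat \<Rightarrow> (int \<Rightarrow> int) set" where
  "FI_A_hom m n = {f \<in> FI_BC_hom m n. \<forall>a\<in>signed_set m. sgn (f a) = sgn a}"

definition FI_D_hom :: "nat \<Rightarrow> nat \<Rightarrow> (int \<Rightarrow> int) set" where
  "FI_D_hom m n = {f \<in> FI_BC_hom m n.
     m = n \<longrightarrow> even (card {a \<in> signed_set m. 0 < a \<and> f a < 0})}"

fun FI_hom :: "weyl_type \<Rightarrow> nat \<Rightarrow> nat \<Rightarrow> (int \<Rightarrow> int) set" where
  "FI_hom Type_A = FI_A_hom"
| "FI_hom Type_BC = FI_BC_hom"
| "FI_hom Type_D = FI_D_hom"

definition FI_id :: "nat \<Rightarrow> int \<Rightarrow> int" where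
  "FI_id n = restrict (\<lambda>a. a) (signed_set n)"

text \<open>
  A functor to \<open>k\<close>-modules: \<open>V n\<close> is its value on the object \<open>n\<close>, and \<open>\<phi> m n f\<close>, of which only
  the restriction to \<open>V m\<close> matters, its value on a morphism \<open>f\<close> from \<open>m\<close> to \<open>n\<close>.
  The vector spaces \<open>V n\<close> are taken to be subspaces of one ambient vector space of arbitrary
  dimension. This is no restriction, since any family of vector spaces embeds in its direct sum;
  the subspaces may overlap, and nothing relates \<open>\<phi>\<close> to the ambient space.
\<close>

locale FI_module = vector_space scale
  for scale :: "'k::field \<Rightarrow> 'v::ab_group_add \<Rightarrow> 'v" +
  fixes W :: weyl_type
    and V :: "nat \<Rightarrow> 'v set"
    and \<phi> :: "nat \<Rightarrow> nat \<Rightarrow> (int \<Rightarrow> int) \<Rightarrow> 'v \<Rightarrow> 'v"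
  assumes subspace_V: "subspace (V n)"
    and map_in: "\<lbrakk>f \<in> FI_hom W m n; x \<in> V m\<rbrakk> \<Longrightarrow> \<phi> m n f x \<in> V n"
    and map_add: "\<lbrakk>f \<in> FI_hom W m n; x \<in> V m; y \<in> V m\<rbrakk>
          \<Longrightarrow> \<phi> m n f (x + y) = \<phi> m n f x + \<phi> m n f y"
    and map_scale: "\<lbrakk>f \<in> FI_hom W m n; x \<in> V m\<rbrakk>
          \<Longrightarrow> \<phi> m n f (scale c x) = scale c (\<phi> m n f x)"
    and map_id: "x \<in> V n \<Longrightarrow> \<phi> n n (FI_id n) x = x"
    and map_comp: "\<lbrakk>f \<in> FI_hom W l m; g \<in> FI_hom W m n; x \<in> V l\<rbrakk>
          \<Longrightarrow> \<phi> l n (compose (signed_set l) g f) x = \<phi> m n g (\<phi> l m f x)"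
begin

definition submodule :: "(nat \<Rightarrow> 'v set) \<Rightarrow> bool" where
  "submodule U \<longleftrightarrow> (\<forall>n. subspace (U n) \<and> U n \<subseteq> V n) \<and>
     (\<forall>m n. \<forall>f\<in>FI_hom W m n. \<forall>x\<in>U m. \<phi> m n f x \<in> U n)"

definition finitely_generated :: bool where
  "finitely_generated \<longleftrightarrow> (\<exists>S. finite S \<and> S \<subseteq> Sigma UNIV V \<and>
     (\<forall>U. submodule U \<and> S \<subseteq> Sigma UNIV U \<longrightarrow> U = V))"

end

end

theory Submission
  imports Defs "HOL-Library.List_Lexorder"
begin

text \<open>
  Already the restriction of \<open>V\<close> to the order-preserving, sign-preserving injections is finitely
  generated. For any of the three categories, a morphism \<open>m \<rightarrow> n\<close> with \<open>m < n\<close> can be written as a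
  morphism \<open>m \<rightarrow> m + 1\<close> followed by an order-preserving one, because no parity condition is imposed
  on morphisms between different objects; for \<open>m = n\<close> it is an endomorphism followed by the identity.
  So it suffices to replace each generator \<open>x\<close> in degree \<open>m\<close> by its finitely many images in degrees
  \<open>m\<close> and \<open>m + 1\<close> (\<open>finitely_generated_increasing\<close>).

  With generators \<open>y\<^sub>i\<close> in degrees \<open>d\<^sub>i\<close>, the space \<open>V n\<close> is spanned by the monomials \<open>i # xs\<close>, where
  \<open>xs\<close> is an increasing list of \<open>d\<^sub>i\<close> positions below \<open>n\<close>, and its dimension is the number of standard
  monomials: those whose value is not in the span of the values of lexicographically smaller ones.
  Order-preserving injections preserve the lexicographic order, so they carry nonstandard monomials
  to nonstandard ones (\<open>standard_monomials_pullback\<close>), just as leading terms behave under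
  multiplication in the theory of Groebner bases.

  Record \<open>xs\<close> by its \<open>d\<^sub>i + 1\<close> gaps, natural numbers with sum \<open>n - d\<^sub>i\<close>. One gap vector can be carried
  to another one by an order-preserving injection if it is componentwise at most the other. Hence,
  for each \<open>i\<close>, the nonstandard gap vectors form an up-set in \<open>\<nat>\<close> to the power \<open>d\<^sub>i + 1\<close>, that is, the
  exponents of a monomial ideal. The number of vectors of given sum outside an up-set is eventually
  polynomial in the sum (\<open>eventually_polynomial_compositions_diff\<close>): by Dickson's lemma only
  finitely many different slices occur, which allows an induction on the number of coordinates.

  Finally, a rational polynomial with integer values at all large natural numbers is
  integer-valued (\<open>poly_integer_valued_if_eventually\<close>).
\<close>

section \<open>Eventually polynomial functions\<close>

definition eventually_polynomial :: "(nat \<Rightarrow> nat) \<Rightarrow> bool" where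
  "eventually_polynomial f \<longleftrightarrow>
    (\<exists>P :: rat poly. \<forall>\<^sub>F n in sequentially. of_nat (f n) = poly P (of_nat n))"

lemma eventually_polynomial_const: "eventually_polynomial (\<lambda>n. c)"
  unfolding eventually_polynomial_def by (rule exI[of _ "[:of_nat c:]"]) simp

lemma eventually_polynomial_cong:
  assumes "eventually_polynomial f" "\<forall>\<^sub>F n in sequentially. g n = f n"
  shows "eventually_polynomial g"
proof -
  obtain P :: "rat poly" where "\<forall>\<^sub>F n in sequentially. of_nat (f n) = poly P (of_nat n)"
    using assms(1) unfolding eventually_polynomial_def by blast
  then have "\<forall>\<^sub>F n in sequentially. of_nat (g n) = poly P (of_nat n)"
    using assms(2) by eventually_elim simp
  then show ?thesis unfolding eventually_polynomial_def by blast
qed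

lemma eventually_polynomial_add:
  assumes "eventually_polynomial f" "eventually_polynomial g"
  shows "eventually_polynomial (\<lambda>n. f n + g n)"
proof -
  obtain P Q :: "rat poly" where
    "\<forall>\<^sub>F n in sequentially. of_nat (f n) = poly P (of_nat n)"
    "\<forall>\<^sub>F n in sequentially. of_nat (g n) = poly Q (of_nat n)"
    using assms unfolding eventually_polynomial_def by blast
  then have "\<forall>\<^sub>F n in sequentially. of_nat (f n + g n) = poly (P + Q) (of_nat n)"
    by eventually_elim simp
  then show ?thesis unfolding eventually_polynomial_def by blast
qed

lemma eventually_polynomial_sum:
  assumes "finite I" "\<And>i. i \<in> I \<Longrightarrow> eventually_polynomial (f i)"
  shows "eventually_polynomial (\<lambda>n. \<Sum>i\<in>I. f i n)"
  using assms
  by (induction I rule: finite_induct)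
    (auto intro: eventually_polynomial_add eventually_polynomial_const)

lemma eventually_polynomial_shift:
  assumes "eventually_polynomial f"
  shows "eventually_polynomial (\<lambda>n. f (n - c))"
proof -
  obtain P :: "rat poly" and N where N: "\<And>n. n \<ge> N \<Longrightarrow> of_nat (f n) = poly P (of_nat n)"
    using assms unfolding eventually_polynomial_def eventually_sequentially by blast
  have "of_nat (f (n - c)) = poly (P \<circ>\<^sub>p [:- of_nat c, 1:]) (of_nat n)" if "n \<ge> N + c" for n
    using N[of "n - c"] that by (simp add: poly_pcompose of_nat_diff)
  then show ?thesis unfolding eventually_polynomial_def eventually_sequentially by blast
qed

text \<open>
  The polynomials \<open>x (x - 1) \<dots> (x - k + 1)\<close> form the basis in which the difference operator acts as
  differentiation does on powers. In this basis antidifferences can be written down.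
\<close>

definition falling_factorial_poly :: "nat \<Rightarrow> rat poly" where
  "falling_factorial_poly k = (\<Prod>i<k. [:- of_nat i, 1:])"

lemma falling_factorial_poly_shift:
  "poly (falling_factorial_poly (Suc k)) (x + 1) = (x + 1) * poly (falling_factorial_poly k) x"
  by (induction k) (auto simp: falling_factorial_poly_def algebra_simps)

lemma falling_factorial_poly_difference:
  "poly (falling_factorial_poly (Suc k)) (x + 1) - poly (falling_factorial_poly (Suc k)) x
    = of_nat (Suc k) * poly (falling_factorial_poly k) x"
proof -
  have "poly (falling_factorial_poly (Suc k)) x = (x - of_nat k) * poly (falling_factorial_poly k) x"
    by (simp add: falling_factorial_poly_def algebra_simps)
  then show ?thesis unfolding falling_factorial_poly_shift by (simp only:) (simp add: algebra_simps)
qed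

lemma degree_falling_factorial_poly: "degree (falling_factorial_poly k) = k"
  unfolding falling_factorial_poly_def by (subst degree_prod_sum_eq) auto

lemma coeff_falling_factorial_poly: "coeff (falling_factorial_poly k) k = 1"
proof -
  have "lead_coeff (falling_factorial_poly k) = 1"
    unfolding falling_factorial_poly_def by (simp add: lead_coeff_prod)
  then show ?thesis by (simp add: degree_falling_factorial_poly)
qed

text \<open>
  Subtracting a multiple of a falling factorial removes the leading term of \<open>Q\<close>, and the falling
  factorial itself has a scaled falling factorial of the next degree as its antidifference.
\<close>

lemma exists_antidifference:
  fixes Q :: "rat poly"
  shows "\<exists>P. \<forall>x. poly P (x + 1) - poly P x = poly Q x"
proof -
  have "\<exists>P. \<forall>x. poly P (x + 1) - poly P x = poly Q x" if "\<forall>i\<ge>k. coeff Q i = 0"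
    for k and Q :: "rat poly"
    using that
  proof (induction k arbitrary: Q)
    case 0
    then have "Q = 0" by (simp add: poly_eq_iff)
    then show ?case by (intro exI[of _ 0]) simp
  next
    case (Suc k)
    define c where "c = coeff Q k"
    define R where "R = Q - smult c (falling_factorial_poly k)"
    have "coeff R i = 0" if "i \<ge> k" for i
    proof (cases "i = k")
      case True
      then show ?thesis by (simp add: R_def c_def coeff_falling_factorial_poly)
    next
      case False
      then have "i > k" using that by simp
      then show ?thesis using Suc.prems
        by (simp add: R_def coeff_eq_0 degree_falling_factorial_poly)
    qed
    then obtain P where P: "\<And>x. poly P (x + 1) - poly P x = poly R x"
      using Suc.IH by blast
    let ?P = "P + smult (c / of_nat (Suc k)) (falling_factorial_poly (Suc k))"
    have "poly ?P (x + 1) - poly ?P x = poly Q x" for x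
    proof -
      have "poly ?P (x + 1) - poly ?P x = poly P (x + 1) - poly P x + c / of_nat (Suc k) *
         (poly (falling_factorial_poly (Suc k)) (x + 1) - poly (falling_factorial_poly (Suc k)) x)"
        by (simp add: algebra_simps)
      also have "\<dots> = poly R x + c * poly (falling_factorial_poly k) x"
        unfolding P falling_factorial_poly_difference by (simp del: of_nat_Suc)
      also have "\<dots> = poly Q x" by (simp add: R_def)
      finally show ?thesis .
    qed
    then show ?case by blast
  qed
  from this[of "Suc (degree Q)" Q] show ?thesis by (simp add: coeff_eq_0)
qed

lemma eventually_polynomial_sum_atMost:
  assumes "eventually_polynomial f"
  shows "eventually_polynomial (\<lambda>t. \<Sum>s\<le>t. f s)"
proof -
  obtain Q :: "rat poly" and N where N: "\<And>n. n \<ge> N \<Longrightarrow> of_nat (f n) = poly Q (of_nat n)"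
    using assms unfolding eventually_polynomial_def eventually_sequentially by blast
  obtain P where P: "\<And>x. poly P (x + 1) - poly P x = poly Q x"
    using exists_antidifference by blast
  define c where "c = of_nat (\<Sum>s\<le>N. f s) - poly P (of_nat N + 1)"
  have "of_nat (\<Sum>s\<le>t. f s) = poly (P \<circ>\<^sub>p [:1, 1:] + [:c:]) (of_nat t)" if "t \<ge> N" for t
    using that
  proof (induction t rule: dec_induct)
    case base
    then show ?case by (simp add: c_def poly_pcompose add.commute)
  next
    case (step t)
    have "of_nat (f (Suc t)) = poly P (of_nat (Suc t) + 1) - poly P (of_nat (Suc t))"
      using N[of "Suc t"] step.hyps P[of "of_nat (Suc t)"] by simp
    with step.IH show ?case by (simp add: poly_pcompose algebra_simps)
  qed
  then show ?thesis unfolding eventually_polynomial_def eventually_sequentially by blast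
qed

text \<open>
  For a common denominator \<open>D\<close> of the coefficients, the values of \<open>P\<close> at integers are periodic modulo
  \<open>\<int>\<close> with period \<open>D\<close>. The bound on the denominator of the values is what carries the induction over
  the coefficients, since
  \<open>(z + E) P (z + E) - z P z = (z + E) (P (z + E) - P z) + E P z\<close>.
\<close>

lemma rational_poly_periodic_mod_ints:
  fixes P :: "rat poly"
  shows "\<exists>D>0. \<forall>E. D dvd E \<longrightarrow> (\<forall>z::int. of_int E * poly P (of_int z) \<in> \<int> \<and>
      poly P (of_int (z + E)) - poly P (of_int z) \<in> \<int>)"
proof (induction P)
  case 0
  show ?case by (rule exI[of _ 1]) simp
next
  case (pCons a P)
  obtain D :: int where D: "D > 0" "\<And>E z. D dvd E \<Longrightarrow> of_int E * poly P (of_int z) \<in> \<int>"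
    "\<And>E z. D dvd E \<Longrightarrow> poly P (of_int (z + E)) - poly P (of_int z) \<in> \<int>"
    using pCons.IH by blast
  obtain p q :: int where a: "q > 0" "a = of_int p / of_int q"
    using quotient_of_denom_pos'[of a] quotient_of_div[of a] by (metis prod.collapse)
  have "of_int E * poly (pCons a P) (of_int z) \<in> \<int> \<and>
      poly (pCons a P) (of_int (z + E)) - poly (pCons a P) (of_int z) \<in> \<int>"
    if E: "q * D dvd E" for E z :: int
  proof -
    have DE: "D dvd E" using E by (rule dvd_mult_right)
    obtain r where r: "E = q * r" using dvd_mult_left[OF E] by (auto elim: dvdE)
    have "of_int E * a = of_int (p * r)" using a by (simp add: r)
    then have "of_int E * a \<in> \<int>" by (metis Ints_of_int)
    moreover have "of_int z * (of_int E * poly P (of_int z)) \<in> \<int>"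
      using D(2)[OF DE] by simp
    ultimately have "of_int E * a + of_int z * (of_int E * poly P (of_int z)) \<in> \<int>"
      by (rule Ints_add)
    moreover have "of_int (z + E) * (poly P (of_int (z + E)) - poly P (of_int z))
        + of_int E * poly P (of_int z) \<in> \<int>"
      by (rule Ints_add[OF Ints_mult[OF Ints_of_int D(3)[OF DE]] D(2)[OF DE]])
    ultimately show ?thesis by (simp add: algebra_simps)
  qed
  moreover have "q * D > 0" using a D by simp
  ultimately show ?case by blast
qed

lemma poly_integer_valued_if_eventually:
  fixes P :: "rat poly" and z :: int
  assumes "\<And>n. n \<ge> N \<Longrightarrow> poly P (of_nat n) \<in> \<int>"
  shows "poly P (of_int z) \<in> \<int>"
proof -
  obtain D :: int where D: "D > 0"
    "\<And>E z. D dvd E \<Longrightarrow> poly P (of_int (z + E)) - poly P (of_int z) \<in> \<int>"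
    using rational_poly_periodic_mod_ints by meson
  \<comment> \<open>a multiple of the period that moves \<open>z\<close> into the range where \<open>P\<close> is known to be integral\<close>
  define E where "E = D * (int N + \<bar>z\<bar>)"
  have "1 * (int N + \<bar>z\<bar>) \<le> E"
    unfolding E_def by (rule mult_right_mono) (use D in auto)
  then have "poly P (of_int (z + E)) \<in> \<int>"
    using assms[of "nat (z + E)"] by simp
  moreover have "poly P (of_int (z + E)) - poly P (of_int z) \<in> \<int>"
    by (rule D) (simp add: E_def)
  ultimately have "poly P (of_int (z + E)) - (poly P (of_int (z + E)) - poly P (of_int z)) \<in> \<int>"
    by (rule Ints_diff)
  then show ?thesis by simp
qed

section \<open>Counting the complement of an up-set of exponent vectors\<close>

lemma nat_seq_mono_subseq:
  fixes a :: "nat \<Rightarrow> nat"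
  shows "\<exists>s :: nat \<Rightarrow> nat. strict_mono s \<and> mono (\<lambda>i. a (s i))"
proof -
  obtain s :: "nat \<Rightarrow> nat" where s: "strict_mono s" "monoseq (\<lambda>i. a (s i))"
    using seq_monosub by blast
  show ?thesis
  proof (cases "incseq (\<lambda>i. a (s i))")
    case False
    then have dec: "decseq (\<lambda>i. a (s i))" using s(2) by (simp add: monoseq_iff)
    \<comment> \<open>a decreasing sequence of natural numbers is constant from the place where it is least\<close>
    define m where "m = (LEAST x. \<exists>i. x = a (s i))"
    obtain i where i: "m = a (s i)" using LeastI_ex[of "\<lambda>x. \<exists>i. x = a (s i)"] unfolding m_def by blast
    have "a (s (i + j)) = m" for j
    proof (rule antisym)
      show "a (s (i + j)) \<le> m" using dec i by (simp add: decseq_def)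
      show "m \<le> a (s (i + j))" unfolding m_def by (rule Least_le) blast
    qed
    moreover have "strict_mono (\<lambda>j. s (i + j))" using s(1) by (simp add: strict_mono_def)
    ultimately show ?thesis by (intro exI[of _ "\<lambda>j. s (i + j)"]) (simp add: mono_def)
  qed (use s in blast)
qed

text \<open>
  Dickson's lemma: thin out the sequence one coordinate at a time.
\<close>

lemma dickson_subseq:
  assumes "\<And>i::nat. length (a i :: nat list) = k"
  shows "\<exists>s :: nat \<Rightarrow> nat. strict_mono s \<and> (\<forall>i j. i \<le> j \<longrightarrow> list_all2 (\<le>) (a (s i)) (a (s j)))"
  using assms
proof (induction k arbitrary: a)
  case 0
  then show ?case by (intro exI[of _ id]) (simp add: strict_mono_def)
next
  case (Suc k)
  have a: "a i = hd (a i) # tl (a i)" for i using Suc.prems[of i] by (cases "a i") auto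
  have "length (tl (a i)) = k" for i using Suc.prems[of i] by simp
  then obtain s :: "nat \<Rightarrow> nat" where s: "strict_mono s"
    "\<And>i j. i \<le> j \<Longrightarrow> list_all2 (\<le>) (tl (a (s i))) (tl (a (s j)))"
    using Suc.IH[of "\<lambda>i. tl (a i)"] by blast
  obtain r :: "nat \<Rightarrow> nat" where r: "strict_mono r" "mono (\<lambda>i. hd (a (s (r i))))"
    using nat_seq_mono_subseq[of "\<lambda>i. hd (a (s i))"] by blast
  have "list_all2 (\<le>) (a (s (r i))) (a (s (r j)))" if "i \<le> j" for i j
  proof -
    have "hd (a (s (r i))) \<le> hd (a (s (r j)))" using r(2) that by (rule monoD)
    moreover have "list_all2 (\<le>) (tl (a (s (r i)))) (tl (a (s (r j))))"
      using s(2) r(1) that by (simp add: strict_mono_less_eq)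
    ultimately show ?thesis by (subst (1 2) a) simp
  qed
  moreover have "strict_mono (\<lambda>i. s (r i))" using s(1) r(1) by (simp add: strict_mono_def)
  ultimately show ?case by (intro exI[of _ "\<lambda>i. s (r i)"]) simp
qed

definition up_closed :: "nat list set \<Rightarrow> bool" where
  "up_closed U \<longleftrightarrow> (\<forall>a\<in>U. \<forall>b. list_all2 (\<le>) a b \<longrightarrow> b \<in> U)"

text \<open>
  The ascending chain condition for monomial ideals. If the chain grew infinitely often, choosing
  one new vector at each growth would give a sequence in which, by Dickson's lemma, some vector lies
  above an earlier one; it would then belong to the chain too early.
\<close>

lemma up_closed_chain_stabilizes:
  fixes U :: "nat \<Rightarrow> nat list set"
  assumes up: "\<And>c. up_closed (U c)" and mono: "mono U"
    and len: "\<And>c a. a \<in> U c \<Longrightarrow> length a = k"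
  shows "\<exists>C. \<forall>c\<ge>C. U c = U C"
proof (rule ccontr)
  assume "\<not> ?thesis"
  then have "\<exists>c>C. \<exists>b. b \<in> U c - U C" for C
    using monoD[OF mono] by (metis DiffI le_neq_implies_less subset_antisym subsetI)
  then obtain next' b where nb: "\<And>C. next' C > C" "\<And>C. b C \<in> U (next' C) - U C"
    by metis
  define r where "r = rec_nat 0 (\<lambda>_. next')"
  have r_Suc: "r (Suc i) = next' (r i)" for i by (simp add: r_def)
  then have r: "strict_mono r" by (simp add: strict_mono_Suc_iff nb)
  define e where "e i = b (r i)" for i
  have "length (e i) = k" for i using len nb unfolding e_def by blast
  then obtain s :: "nat \<Rightarrow> nat" where s: "strict_mono s"
    "\<And>i j. i \<le> j \<Longrightarrow> list_all2 (\<le>) (e (s i)) (e (s j))"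
    using dickson_subseq by blast
  have "Suc (s 0) \<le> s 1" using s(1) by (simp add: strict_mono_less Suc_le_eq)
  then have "U (r (Suc (s 0))) \<subseteq> U (r (s 1))"
    using mono r by (simp add: monoD strict_mono_less_eq)
  then have "e (s 0) \<in> U (r (s 1))" using nb(2)[of "r (s 0)"] by (auto simp: e_def r_Suc)
  then have "e (s 1) \<in> U (r (s 1))" using s(2)[of 0 1] up unfolding up_closed_def by simp
  then show False using nb(2)[of "r (s 1)"] by (simp add: e_def)
qed

definition compositions :: "nat \<Rightarrow> nat \<Rightarrow> nat list set" where
  "compositions k t = {a. length a = k \<and> sum_list a = t}"

lemma finite_compositions: "finite (compositions k t)"
proof (rule finite_subset)
  show "compositions k t \<subseteq> {a. set a \<subseteq> {..t} \<and> length a = k}"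
    using member_le_sum_list by (fastforce simp: compositions_def)
  show "finite {a. set a \<subseteq> {..t} \<and> length a = k}"
    by (rule finite_lists_length_eq) simp
qed

lemma card_compositions_Suc_diff:
  "card (compositions (Suc k) t - U) = (\<Sum>c\<le>t. card (compositions k (t - c) - {b. c # b \<in> U}))"
proof -
  have "compositions (Suc k) t - U
      = (\<Union>c\<le>t. (#) c ` (compositions k (t - c) - {b. c # b \<in> U}))"
  proof (rule set_eqI)
    fix a
    show "a \<in> compositions (Suc k) t - U
        \<longleftrightarrow> a \<in> (\<Union>c\<le>t. (#) c ` (compositions k (t - c) - {b. c # b \<in> U}))"
      by (cases a) (auto simp: compositions_def image_iff intro!: bexI[of _ "hd a"])
  qed
  also have "card \<dots> = (\<Sum>c\<le>t. card ((#) c ` (compositions k (t - c) - {b. c # b \<in> U})))"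
    by (rule card_UN_disjoint) (auto simp: finite_compositions)
  also have "\<dots> = (\<Sum>c\<le>t. card (compositions k (t - c) - {b. c # b \<in> U}))"
    by (intro sum.cong refl card_image) (simp add: inj_on_def)
  finally show ?thesis .
qed

text \<open>
  The Hilbert function of a monomial ideal, by slicing along the first coordinate \<open>c\<close>. The slices
  increase with \<open>c\<close> and equal the slice at some \<open>C\<close> from there on. The slices below \<open>C\<close> contribute
  finitely many shifted counts in one coordinate less, and all the others together a sum of the
  count for the slice at \<open>C\<close> over all smaller totals.
\<close>

lemma eventually_polynomial_compositions_diff:
  assumes "up_closed U" "\<And>a. a \<in> U \<Longrightarrow> length a = k"
  shows "eventually_polynomial (\<lambda>t. card (compositions k t - U))"
  using assms
proof (induction k arbitrary: U)
  case 0
  have "\<forall>\<^sub>F t in sequentially. card (compositions 0 t - U) = 0"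
    using eventually_gt_at_top[of 0] by eventually_elim (auto simp: compositions_def)
  with eventually_polynomial_const show ?case by (rule eventually_polynomial_cong)
next
  case (Suc k)
  define slice where "slice c = {b. c # b \<in> U}" for c
  define f where "f c t = card (compositions k t - slice c)" for c t
  have up: "up_closed (slice c)" for c
    using Suc.prems(1) by (auto simp: up_closed_def slice_def)
  have len: "length b = k" if "b \<in> slice c" for b c
    using Suc.prems(2)[of "c # b"] that by (simp add: slice_def)
  have mono: "mono slice"
  proof (rule monoI, rule subsetI)
    fix c c' :: nat and b assume "c \<le> c'" "b \<in> slice c"
    then show "b \<in> slice c'" using Suc.prems(1)
      by (auto simp: up_closed_def slice_def list_all2_refl)
  qed
  have f: "eventually_polynomial (f c)" for c
    unfolding f_def by (rule Suc.IH[OF up len])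
  obtain C where C: "\<And>c. c \<ge> C \<Longrightarrow> slice c = slice C"
    using up_closed_chain_stabilizes[of slice k] up mono len by blast
  have "card (compositions (Suc k) t - U)
      = (\<Sum>c<C. f c (t - c)) + (\<Sum>s\<le>t - C. f C s)" if "t \<ge> C" for t
  proof -
    have "card (compositions (Suc k) t - U) = (\<Sum>c\<le>t. f c (t - c))"
      by (simp add: card_compositions_Suc_diff f_def slice_def)
    also have "{..t} = {..<C} \<union> {C..t}" using that by auto
    also have "(\<Sum>c\<in>{..<C} \<union> {C..t}. f c (t - c))
        = (\<Sum>c<C. f c (t - c)) + (\<Sum>c\<in>{C..t}. f c (t - c))"
      by (rule sum.union_disjoint) auto
    also have "(\<Sum>c\<in>{C..t}. f c (t - c)) = (\<Sum>c\<in>{C..t}. f C (t - c))"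
      unfolding f_def by (intro sum.cong refl) (metis C atLeastAtMost_iff)
    also have "\<dots> = (\<Sum>s\<le>t - C. f C s)"
      by (rule sum.reindex_bij_witness[of _ "\<lambda>s. t - s" "\<lambda>c. t - c"]) (use that in auto)
    finally show ?thesis .
  qed
  then have "\<forall>\<^sub>F t in sequentially. card (compositions (Suc k) t - U)
      = (\<Sum>c<C. f c (t - c)) + (\<Sum>s\<le>t - C. f C s)"
    unfolding eventually_sequentially by blast
  moreover have "eventually_polynomial (\<lambda>t. (\<Sum>c<C. f c (t - c)) + (\<Sum>s\<le>t - C. f C s))"
  proof (rule eventually_polynomial_add)
    show "eventually_polynomial (\<lambda>t. \<Sum>c<C. f c (t - c))"
      by (rule eventually_polynomial_sum[OF finite_lessThan eventually_polynomial_shift[OF f]])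
    show "eventually_polynomial (\<lambda>t. \<Sum>s\<le>t - C. f C s)"
      by (rule eventually_polynomial_shift[OF eventually_polynomial_sum_atMost[OF f]])
  qed
  ultimately show ?case by (rule eventually_polynomial_cong[rotated])
qed

section \<open>Order-preserving injections as gap vectors\<close>

definition increasing_lists :: "nat \<Rightarrow> nat \<Rightarrow> nat list set" where
  "increasing_lists d n = {xs. length xs = d \<and> sorted_wrt (<) xs \<and> set xs \<subseteq> {..<n}}"

lemma finite_increasing_lists: "finite (increasing_lists d n)"
  by (rule finite_subset[OF _ finite_lists_length_eq[of "{..<n}" d]]) (auto simp: increasing_lists_def)

text \<open>
  A list of \<open>d + 1\<close> gaps determines \<open>d\<close> positions: the entry \<open>a\<close> says how many unused positions
  precede the next used one. The last gap counts the unused positions at the end, so it is visible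
  only in the size \<open>sum_list a + d\<close> of the ambient interval.
\<close>

fun from_gaps :: "nat list \<Rightarrow> nat list" where
  "from_gaps (a # b # as) = a # map (\<lambda>x. a + 1 + x) (from_gaps (b # as))"
| "from_gaps _ = []"

lemma from_gaps_Cons: "as \<noteq> [] \<Longrightarrow> from_gaps (a # as) = a # map (\<lambda>x. a + 1 + x) (from_gaps as)"
  by (cases as) auto

lemma from_gaps_increasing:
  assumes "length a = Suc d"
  shows "from_gaps a \<in> increasing_lists d (sum_list a + d)"
  using assms
proof (induction d arbitrary: a)
  case 0
  then show ?case by (auto simp: length_Suc_conv increasing_lists_def)
next
  case (Suc d)
  then obtain c b where a: "a = c # b" "length b = Suc d" by (auto simp: length_Suc_conv)
  then have "b \<noteq> []" by auto
  with Suc.IH[OF a(2)] a show ?case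
    by (auto simp: increasing_lists_def from_gaps_Cons sorted_wrt_map)
qed

lemma from_gaps_inj:
  assumes "length a = Suc d" "length b = Suc d" "sum_list a = sum_list b" "from_gaps a = from_gaps b"
  shows "a = b"
  using assms
proof (induction d arbitrary: a b)
  case 0
  then show ?case by (auto simp: length_Suc_conv)
next
  case (Suc d)
  obtain c a' where a: "a = c # a'" "length a' = Suc d"
    using Suc.prems by (auto simp: length_Suc_conv)
  obtain e b' where b: "b = e # b'" "length b' = Suc d"
    using Suc.prems(2) by (auto simp: length_Suc_conv)
  have ne: "a' \<noteq> []" "b' \<noteq> []" using a b by auto
  have ce: "c = e" and "map (\<lambda>x. c + 1 + x) (from_gaps a') = map (\<lambda>x. c + 1 + x) (from_gaps b')"
    using Suc.prems(4) by (auto simp: a(1) b(1) from_gaps_Cons[OF ne(1)] from_gaps_Cons[OF ne(2)])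
  then have "from_gaps a' = from_gaps b'" by (simp add: inj_map_eq_map inj_on_def)
  then show ?case using Suc.IH[OF a(2) b(2)] Suc.prems(3) ce a b by simp
qed

lemma from_gaps_surj:
  assumes "xs \<in> increasing_lists d n"
  shows "\<exists>a. length a = Suc d \<and> sum_list a + d = n \<and> from_gaps a = xs"
  using assms
proof (induction d arbitrary: xs n)
  case 0
  then show ?case by (intro exI[of _ "[n]"]) (auto simp: increasing_lists_def)
next
  case (Suc d)
  then obtain x ys where xs: "xs = x # ys" by (auto simp: increasing_lists_def length_Suc_conv)
  have *: "length ys = d" "sorted_wrt (<) ys" "\<And>y. y \<in> set ys \<Longrightarrow> x < y \<and> y < n" "x < n"
    using Suc.prems by (auto simp: increasing_lists_def xs)
  define zs where "zs = map (\<lambda>y. y - (x + 1)) ys"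
  have "sorted_wrt (<) zs" unfolding zs_def sorted_wrt_map
    by (rule sorted_wrt_mono_rel[OF _ *(2)]) (use *(3) in force)
  then have "zs \<in> increasing_lists d (n - (x + 1))"
    using * by (force simp: increasing_lists_def zs_def)
  then obtain a where a: "length a = Suc d" "sum_list a + d = n - (x + 1)" "from_gaps a = zs"
    using Suc.IH by blast
  have "map (\<lambda>y. x + 1 + y) zs = ys"
    unfolding zs_def map_map by (rule map_idI) (use *(3) in force)
  moreover have "a \<noteq> []" using a by auto
  ultimately show ?case using a *(4) by (intro exI[of _ "x # a"]) (simp add: from_gaps_Cons xs)
qed

text \<open>
  Enlarging gaps amounts to inserting unused positions, which is what post-composition with an
  order-preserving injection does. Requiring \<open>h\<close> to be strictly monotone on all natural numbers, and
  not just on the relevant interval, makes it easy to extend by one more gap in the induction.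
\<close>

lemma gaps_le_imp_strict_mono_map:
  assumes "list_all2 (\<le>) a b" "length a = Suc d"
  shows "\<exists>h :: nat \<Rightarrow> nat. strict_mono h \<and> (\<forall>x < sum_list a + d. h x < sum_list b + d) \<and>
    map h (from_gaps a) = from_gaps b"
  using assms
proof (induction d arbitrary: a b)
  case 0
  then show ?case
    by (intro exI[of _ id]) (auto simp: length_Suc_conv list_all2_Cons1 strict_mono_def)
next
  case (Suc d)
  obtain c a' where a: "a = c # a'" "length a' = Suc d"
    using Suc.prems by (auto simp: length_Suc_conv)
  then obtain e b' where b: "b = e # b'" "c \<le> e" "list_all2 (\<le>) a' b'"
    using Suc.prems(1) by (auto simp: list_all2_Cons1)
  have ne: "a' \<noteq> []" "b' \<noteq> []" using a b list_all2_lengthD[OF b(3)] by auto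
  obtain h :: "nat \<Rightarrow> nat" where h: "strict_mono h" "\<And>x. x < sum_list a' + d \<Longrightarrow> h x < sum_list b' + d"
    "map h (from_gaps a') = from_gaps b'"
    using Suc.IH[OF b(3) a(2)] by blast
  \<comment> \<open>positions inside the first gap stay, its end moves from \<open>c\<close> to \<open>e\<close>, and \<open>h\<close> acts behind it\<close>
  define g where "g x = (if x < c then x else if x = c then e else e + 1 + h (x - (c + 1)))" for x
  have "strict_mono g"
  proof (rule strict_monoI)
    fix x y :: nat assume "x < y"
    moreover have "h (x - (c + 1)) < h (y - (c + 1))" if "c < x"
      by (rule strict_monoD[OF h(1)]) (use that \<open>x < y\<close> in simp)
    ultimately show "g x < g y" using b(2) by (auto simp: g_def)
  qed
  moreover have "g x < sum_list b + Suc d" if "x < sum_list a + Suc d" for x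
    using h(2)[of "x - (c + 1)"] that a b by (auto simp: g_def)
  moreover have "map g (from_gaps a) = from_gaps b"
  proof -
    have "(\<lambda>x. g (c + 1 + x)) = (\<lambda>x. e + 1 + h x)" by (auto simp: g_def)
    then show ?thesis
      by (simp add: a b from_gaps_Cons ne h(3)[symmetric] comp_def) (simp add: g_def)
  qed
  ultimately show ?case by blast
qed

section \<open>Morphisms\<close>

lemma signed_set_uminus: "a \<in> signed_set n \<Longrightarrow> - a \<in> signed_set n"
  by (simp add: signed_set_def)

lemma signed_set_eq: "signed_set n = {- int n..-1} \<union> {1..int n}"
  by (auto simp: signed_set_def)

lemma finite_signed_set: "finite (signed_set n)"
  by (simp add: signed_set_eq)

lemma card_signed_set: "card (signed_set n) = 2 * n"
  unfolding signed_set_eq by (subst card_Un_disjoint) auto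

lemma finite_FI_hom: "finite (FI_hom W m n)"
proof (rule finite_subset)
  show "FI_hom W m n \<subseteq> signed_set m \<rightarrow>\<^sub>E signed_set n"
    by (cases W) (auto simp: FI_A_hom_def FI_BC_hom_def FI_D_hom_def)
qed (simp add: finite_PiE finite_signed_set)

lemma FI_hom_subset_BC: "FI_hom W m n \<subseteq> FI_BC_hom m n"
  by (cases W) (auto simp: FI_A_hom_def FI_D_hom_def)

lemma FI_A_hom_subset: "FI_A_hom m n \<subseteq> FI_hom W m n"
proof (cases W)
  case Type_D
  have "f \<in> FI_D_hom m n" if f: "f \<in> FI_A_hom m n" for f
  proof -
    have "\<not> f a < 0" if "a \<in> signed_set m" "0 < a" for a
    proof -
      have "sgn (f a) = sgn a" using that f by (simp add: FI_A_hom_def)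
      then show ?thesis using that(2) by (simp add: sgn_if split: if_splits)
    qed
    then have "{a \<in> signed_set m. 0 < a \<and> f a < 0} = {}" by blast
    then have "even (card {a \<in> signed_set m. 0 < a \<and> f a < 0})" by (simp only: card.empty even_zero)
    then show ?thesis using f unfolding FI_D_hom_def FI_A_hom_def by blast
  qed
  then show ?thesis using Type_D by auto
qed (auto simp: FI_A_hom_def)

lemma FI_BC_hom_le:
  assumes "f \<in> FI_BC_hom m n"
  shows "m \<le> n"
proof -
  have "card (signed_set m) \<le> card (signed_set n)"
    using assms by (intro card_inj_on_le[of f]) (auto simp: FI_BC_hom_def finite_signed_set)
  then show ?thesis by (simp add: card_signed_set)
qed

lemma FI_BC_hom_compose:
  assumes "f \<in> FI_BC_hom l m" "g \<in> FI_BC_hom m n"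
  shows "compose (signed_set l) g f \<in> FI_BC_hom l n"
proof -
  have "f a \<in> signed_set m" if "a \<in> signed_set l" for a
    using assms(1) that by (auto simp: FI_BC_hom_def)
  then show ?thesis using assms
    by (auto simp: FI_BC_hom_def compose_def inj_on_def signed_set_uminus)
qed

text \<open>
  The number of reversed signs enters only through its parity, and a product of signs is easier to
  compose than a cardinality.
\<close>

lemma prod_sgn_eq_1_iff_even:
  assumes "f \<in> FI_BC_hom m n"
  shows "(\<Prod>a\<in>{1..int m}. sgn (f a)) = 1 \<longleftrightarrow> even (card {a \<in> signed_set m. 0 < a \<and> f a < 0})"
proof -
  let ?N = "{a \<in> signed_set m. 0 < a \<and> f a < 0}"
  have ne: "f a \<noteq> 0" if "a \<in> {1..int m}" for a
  proof -
    have "f a \<in> signed_set n" using assms that by (auto simp: FI_BC_hom_def signed_set_def)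
    then show ?thesis by (auto simp: signed_set_def)
  qed
  have "(\<Prod>a\<in>{1..int m}. sgn (f a)) = (\<Prod>a\<in>?N. sgn (f a))"
  proof (rule prod.mono_neutral_right)
    show "?N \<subseteq> {1..int m}" by (auto simp: signed_set_def)
    show "\<forall>a\<in>{1..int m} - ?N. sgn (f a) = 1"
    proof
      fix a assume a: "a \<in> {1..int m} - ?N"
      then have "\<not> f a < 0" by (simp add: signed_set_def)
      moreover have "f a \<noteq> 0" using a by (intro ne) simp
      ultimately show "sgn (f a) = 1" by simp
    qed
  qed simp
  also have "\<dots> = (\<Prod>a\<in>?N. - 1)" by (rule prod.cong) auto
  also have "\<dots> = (- 1) ^ card ?N" by simp
  finally show ?thesis by (simp add: minus_one_power_iff)
qed

lemma prod_sgn_compose: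
  assumes f: "f \<in> FI_BC_hom m m" and g: "g \<in> FI_BC_hom m n"
  shows "(\<Prod>a\<in>{1..int m}. sgn (compose (signed_set m) g f a))
    = (\<Prod>a\<in>{1..int m}. sgn (f a)) * (\<Prod>a\<in>{1..int m}. sgn (g a))"
proof -
  have pos: "{1..int m} \<subseteq> signed_set m" by (auto simp: signed_set_def)
  have fa: "f a \<in> signed_set m" if "a \<in> signed_set m" for a
    using f that by (auto simp: FI_BC_hom_def)
  have "sgn (compose (signed_set m) g f a) = sgn (f a) * sgn (g \<bar>f a\<bar>)" if "a \<in> {1..int m}" for a
  proof -
    have *: "a \<in> signed_set m" "f a \<in> signed_set m" using fa that pos by blast+
    then have "g (- f a) = - g (f a)" using g by (simp add: FI_BC_hom_def)
    moreover have "f a \<noteq> 0" using *(2) by (auto simp: signed_set_def)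
    ultimately show ?thesis using that pos by (auto simp: compose_def abs_if sgn_if)
  qed
  then have "(\<Prod>a\<in>{1..int m}. sgn (compose (signed_set m) g f a))
      = (\<Prod>a\<in>{1..int m}. sgn (f a)) * (\<Prod>a\<in>{1..int m}. sgn (g \<bar>f a\<bar>))"
    by (simp add: prod.distrib)
  \<comment> \<open>the absolute values of \<open>f\<close> permute the positive elements\<close>
  also have "(\<Prod>a\<in>{1..int m}. sgn (g \<bar>f a\<bar>)) = (\<Prod>a\<in>{1..int m}. sgn (g a))"
  proof (rule prod.reindex_bij_betw)
    have "inj_on (\<lambda>a. \<bar>f a\<bar>) {1..int m}"
    proof (rule inj_onI)
      fix a b assume ab: "a \<in> {1..int m}" "b \<in> {1..int m}" "\<bar>f a\<bar> = \<bar>f b\<bar>"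
      have "f (- b) = - f b" using f ab pos by (auto simp: FI_BC_hom_def)
      then have "f a = f b \<or> f a = f (- b)" using ab(3) by linarith
      moreover have "inj_on f (signed_set m)" using f by (simp add: FI_BC_hom_def)
      moreover have "a \<in> signed_set m" "b \<in> signed_set m" "- b \<in> signed_set m"
        using ab pos signed_set_uminus by auto
      ultimately have "a = b \<or> a = - b" by (meson inj_onD)
      then show "a = b" using ab by auto
    qed
    moreover have "(\<lambda>a. \<bar>f a\<bar>) ` {1..int m} \<subseteq> {1..int m}"
      using fa pos by (force simp: signed_set_def)
    ultimately show "bij_betw (\<lambda>a. \<bar>f a\<bar>) {1..int m} {1..int m}"
      by (simp add: bij_betw_def endo_inj_surj)
  qed
  finally show ?thesis .
qed

text \<open>
  In type D the parity condition concerns a composite \<open>l \<rightarrow> m \<rightarrow> n\<close> with \<open>l = n\<close>. Then injectivity forces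
  \<open>l = m = n\<close>, so both factors satisfy the condition as well.
\<close>

lemma FI_hom_compose:
  assumes f: "f \<in> FI_hom W l m" and g: "g \<in> FI_hom W m n"
  shows "compose (signed_set l) g f \<in> FI_hom W l n"
proof -
  have bc: "f \<in> FI_BC_hom l m" "g \<in> FI_BC_hom m n" using f g FI_hom_subset_BC by blast+
  note comp = FI_BC_hom_compose[OF bc]
  show ?thesis
  proof (cases W)
    case Type_A
    have "f a \<in> signed_set m" if "a \<in> signed_set l" for a
      using bc(1) that by (auto simp: FI_BC_hom_def)
    then show ?thesis using f g comp Type_A by (auto simp: FI_A_hom_def compose_def)
  next
    case Type_BC
    then show ?thesis using comp by simp
  next
    case Type_D
    have "even (card {a \<in> signed_set l. 0 < a \<and> compose (signed_set l) g f a < 0})" if "l = n"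
    proof -
      have "l = m" "m = n" using FI_BC_hom_le[OF bc(1)] FI_BC_hom_le[OF bc(2)] that by auto
      then have *: "f \<in> FI_BC_hom m m" "g \<in> FI_BC_hom m m" "compose (signed_set m) g f \<in> FI_BC_hom m m"
        using bc comp by auto
      have "(\<Prod>a\<in>{1..int m}. sgn (f a)) = 1" "(\<Prod>a\<in>{1..int m}. sgn (g a)) = 1"
        using f g Type_D \<open>l = m\<close> \<open>m = n\<close>
          prod_sgn_eq_1_iff_even[OF *(1)] prod_sgn_eq_1_iff_even[OF *(2)]
        by (simp_all add: FI_D_hom_def)
      then have "(\<Prod>a\<in>{1..int m}. sgn (compose (signed_set m) g f a)) = 1"
        by (simp add: prod_sgn_compose[OF *(1,2)])
      then show ?thesis using prod_sgn_eq_1_iff_even[OF *(3)] \<open>l = m\<close> by simp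
    qed
    then show ?thesis using comp Type_D by (simp add: FI_D_hom_def)
  qed
qed

text \<open>
  Positions in lists are counted from 0 and the positive elements of \<open>signed_set\<close> from 1, which is
  why 1 is subtracted and added again.
\<close>

definition increasing_hom :: "nat \<Rightarrow> nat list \<Rightarrow> int \<Rightarrow> int" where
  "increasing_hom d xs = restrict (\<lambda>z. sgn z * (int (xs ! (nat \<bar>z\<bar> - 1)) + 1)) (signed_set d)"

lemma increasing_hom_in_FI_A_hom:
  assumes "xs \<in> increasing_lists d n"
  shows "increasing_hom d xs \<in> FI_A_hom d n"
proof -
  have xs: "length xs = d" "distinct xs" "set xs \<subseteq> {..<n}"
    using assms by (auto simp: increasing_lists_def strict_sorted_iff)
  have idx: "nat \<bar>z\<bar> - 1 < d" "z \<noteq> 0" if "z \<in> signed_set d" for z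
    using that by (auto simp: signed_set_def)
  have val: "xs ! (nat \<bar>z\<bar> - 1) < n" if "z \<in> signed_set d" for z
    using idx[OF that] xs nth_mem by blast
  have sgn: "sgn (increasing_hom d xs z) = sgn z" if "z \<in> signed_set d" for z
    using that by (simp add: increasing_hom_def sgn_mult)
  have "inj_on (increasing_hom d xs) (signed_set d)"
  proof (rule inj_onI)
    fix z w assume zw: "z \<in> signed_set d" "w \<in> signed_set d"
      and eq: "increasing_hom d xs z = increasing_hom d xs w"
    then have s: "sgn z = sgn w" using sgn by metis
    have "sgn w \<noteq> 0" using idx(2)[OF zw(2)] by (simp add: sgn_0_0)
    then have "xs ! (nat \<bar>z\<bar> - 1) = xs ! (nat \<bar>w\<bar> - 1)"
      using eq zw s by (simp add: increasing_hom_def)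
    then have "nat \<bar>z\<bar> - 1 = nat \<bar>w\<bar> - 1"
      using idx zw xs by (simp add: nth_eq_iff_index_eq)
    then have "\<bar>z\<bar> = \<bar>w\<bar>"
      using zw unfolding signed_set_def mem_Collect_eq by arith
    with s show "z = w" by (metis abs_sgn mult_sgn_abs)
  qed
  moreover have "increasing_hom d xs z \<in> signed_set n" if "z \<in> signed_set d" for z
    using val[OF that] idx[OF that] that by (auto simp: increasing_hom_def signed_set_def abs_mult)
  moreover have "increasing_hom d xs (- z) = - increasing_hom d xs z" if "z \<in> signed_set d" for z
    using that signed_set_uminus by (simp add: increasing_hom_def)
  ultimately show ?thesis using sgn
    by (auto simp: FI_A_hom_def FI_BC_hom_def) (simp add: increasing_hom_def)
qed

lemma increasing_hom_in_FI_hom: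
  "xs \<in> increasing_lists d n \<Longrightarrow> increasing_hom d xs \<in> FI_hom W d n"
  using increasing_hom_in_FI_A_hom FI_A_hom_subset by blast

lemma upt_in_increasing_lists: "[0..<n] \<in> increasing_lists n n"
  by (auto simp: increasing_lists_def)

lemma increasing_hom_upt: "increasing_hom n [0..<n] = FI_id n"
proof
  fix z show "increasing_hom n [0..<n] z = FI_id n z"
  proof (cases "z \<in> signed_set n")
    case True
    then have "nat \<bar>z\<bar> - 1 < n" "1 \<le> \<bar>z\<bar>" by (auto simp: signed_set_def)
    then show ?thesis using True
      by (simp add: increasing_hom_def FI_id_def of_nat_diff mult_sgn_abs)
  qed (simp add: increasing_hom_def FI_id_def)
qed

lemma FI_id_in_FI_hom: "FI_id n \<in> FI_hom W n n"
  using increasing_hom_in_FI_hom[OF upt_in_increasing_lists] by (simp add: increasing_hom_upt)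

lemma map_in_increasing_lists:
  assumes "xs \<in> increasing_lists d n" "strict_mono h" "\<And>x. x < n \<Longrightarrow> h x < n'"
  shows "map h xs \<in> increasing_lists d n'"
  using assms by (auto simp: increasing_lists_def sorted_wrt_map strict_mono_less)

lemma compose_increasing_hom:
  assumes "xs \<in> increasing_lists d n"
  shows "compose (signed_set d) (increasing_hom n (map h [0..<n])) (increasing_hom d xs)
    = increasing_hom d (map h xs)"
proof
  fix z
  show "compose (signed_set d) (increasing_hom n (map h [0..<n])) (increasing_hom d xs) z
    = increasing_hom d (map h xs) z"
  proof (cases "z \<in> signed_set d")
    case True
    let ?i = "nat \<bar>z\<bar> - 1"
    have i: "?i < d" "z \<noteq> 0" using True by (auto simp: signed_set_def)
    then have x: "xs ! ?i < n" "?i < length xs"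
      using assms nth_mem by (auto simp: increasing_lists_def)
    have y: "increasing_hom d xs z = sgn z * (int (xs ! ?i) + 1)"
      using True by (simp add: increasing_hom_def)
    have "\<bar>increasing_hom d xs z\<bar> = int (xs ! ?i) + 1" using i by (simp add: y abs_mult)
    moreover have "increasing_hom d xs z \<in> signed_set n"
      using calculation x by (simp add: signed_set_def)
    moreover have "sgn (increasing_hom d xs z) = sgn z" by (simp add: y sgn_mult)
    ultimately have "increasing_hom n (map h [0..<n]) (increasing_hom d xs z)
        = sgn z * (int (h (xs ! ?i)) + 1)"
      using x by (simp add: increasing_hom_def[of n] nat_add_distrib)
    then show ?thesis using True x by (simp add: compose_def increasing_hom_def[of d "map h xs"])
  qed (simp add: compose_def increasing_hom_def)
qed

text \<open>
  The factor is \<open>f\<close> followed by the inverse of \<open>g\<close>. In type A it preserves signs because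
  \<open>f\<close> and \<open>g\<close> do; in type D the hypothesis \<open>m \<noteq> d\<close> makes the parity condition vacuous.
\<close>

lemma FI_hom_factor_through:
  assumes f: "f \<in> FI_hom W m n" and g: "g \<in> FI_A_hom d n"
    and sub: "f ` signed_set m \<subseteq> g ` signed_set d" and "m \<noteq> d"
  shows "\<exists>h \<in> FI_hom W m d. f = compose (signed_set m) g h"
proof -
  have f': "f \<in> FI_BC_hom m n" using f FI_hom_subset_BC by blast
  have g': "inj_on g (signed_set d)" "\<And>a. a \<in> signed_set d \<Longrightarrow> g (- a) = - g a"
    "\<And>a. a \<in> signed_set d \<Longrightarrow> sgn (g a) = sgn a"
    using g by (auto simp: FI_A_hom_def FI_BC_hom_def)
  define h where "h = restrict (\<lambda>a. inv_into (signed_set d) g (f a)) (signed_set m)"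
  have h: "h a \<in> signed_set d" "g (h a) = f a" if "a \<in> signed_set m" for a
    using that sub inv_into_into[of "f a" g] f_inv_into_f[of "f a" g] by (auto simp: h_def)
  have h_uminus: "h (- a) = - h a" if "a \<in> signed_set m" for a
  proof -
    have "g (h (- a)) = g (- h a)"
      using h[OF that] h[OF signed_set_uminus[OF that]] g'(2) f' that by (simp add: FI_BC_hom_def)
    then show ?thesis
      using g'(1) h(1) signed_set_uminus that by (meson inj_onD)
  qed
  have "inj_on h (signed_set m)"
  proof (rule inj_onI)
    fix a b assume ab: "a \<in> signed_set m" "b \<in> signed_set m" "h a = h b"
    then have "f a = f b" using h(2) by metis
    then show "a = b" using f' ab by (auto simp: FI_BC_hom_def dest: inj_onD)
  qed
  then have bc: "h \<in> FI_BC_hom m d"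
    using h(1) h_uminus by (auto simp: FI_BC_hom_def) (simp add: h_def)
  have hom: "h \<in> FI_hom W m d"
  proof (cases W)
    case Type_A
    have "sgn (h a) = sgn a" if "a \<in> signed_set m" for a
      using g'(3)[OF h(1)[OF that]] h(2)[OF that] f that Type_A by (simp add: FI_A_hom_def)
    then show ?thesis using bc Type_A by (simp add: FI_A_hom_def)
  qed (use bc \<open>m \<noteq> d\<close> in \<open>simp_all add: FI_D_hom_def\<close>)
  have eq: "f = compose (signed_set m) g h"
  proof
    fix a show "f a = compose (signed_set m) g h a"
    proof (cases "a \<in> signed_set m")
      case True
      then show ?thesis using h(2) by (simp add: compose_def)
    next
      case False
      have "f \<in> signed_set m \<rightarrow>\<^sub>E signed_set n" using f' by (simp add: FI_BC_hom_def)
      then show ?thesis using PiE_arb[of f _ _ a] False by (simp add: compose_def)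
    qed
  qed
  show ?thesis by (rule bexI[of _ h], rule eq, rule hom)
qed

text \<open>
  For \<open>m < n\<close> the absolute values of \<open>f\<close> occupy \<open>m\<close> positions. Adding one spare position gives a set of
  size \<open>m + 1\<close>, whose increasing enumeration is the second factor. The spare position ensures that
  the first factor goes between different objects, so that in type D no parity has to be respected.
\<close>

lemma FI_hom_factor_increasing:
  assumes f: "f \<in> FI_hom W m n"
  shows "\<exists>d\<in>{m, Suc m}. \<exists>xs\<in>increasing_lists d n. \<exists>h\<in>FI_hom W m d.
    f = compose (signed_set m) (increasing_hom d xs) h"
proof (cases "m = n")
  case True
  have "f \<in> FI_BC_hom m n" using f FI_hom_subset_BC by blast
  then have f': "f \<in> signed_set m \<rightarrow>\<^sub>E signed_set n" by (simp add: FI_BC_hom_def)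
  have eq: "f = compose (signed_set m) (increasing_hom m [0..<m]) f"
  proof
    fix a show "f a = compose (signed_set m) (increasing_hom m [0..<m]) f a"
      using PiE_mem[OF f', of a] PiE_arb[OF f', of a] True
      by (cases "a \<in> signed_set m") (simp_all add: compose_def increasing_hom_upt FI_id_def)
  qed
  show ?thesis
    by (rule bexI[of _ m], rule bexI[of _ "[0..<m]"], rule bexI[of _ f], rule eq)
      (use f upt_in_increasing_lists[of m] True in simp_all)
next
  case False
  have f': "f \<in> FI_BC_hom m n" using f FI_hom_subset_BC by blast
  then have "m < n" using FI_BC_hom_le False by (simp add: order_le_neq_trans)
  have fa: "f a \<in> signed_set n" if "a \<in> signed_set m" for a
    using f' that by (auto simp: FI_BC_hom_def)
  define A where "A = (\<lambda>a. nat \<bar>f a\<bar> - 1) ` {1..int m}"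
  have "card A \<le> card {1..int m}" unfolding A_def by (rule card_image_le) simp
  moreover have "A \<subseteq> {..<n}"
  proof
    fix x assume "x \<in> A"
    then obtain a where a: "a \<in> {1..int m}" "x = nat \<bar>f a\<bar> - 1" by (auto simp: A_def)
    then have "f a \<in> signed_set n" by (intro fa) (auto simp: signed_set_def)
    then show "x \<in> {..<n}" using a(2) by (auto simp: signed_set_def)
  qed
  ultimately obtain B where B: "A \<subseteq> B" "B \<subseteq> {..<n}" "card B = Suc m"
    using exists_subset_between[of A "Suc m" "{..<n}"] \<open>m < n\<close> by auto
  then have fin: "finite B" using finite_subset by blast
  define xs where "xs = sorted_list_of_set B"
  have xs: "xs \<in> increasing_lists (Suc m) n"
    using B fin by (auto simp: xs_def increasing_lists_def)
  have "f a \<in> increasing_hom (Suc m) xs ` signed_set (Suc m)" if "a \<in> signed_set m" for a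
  proof -
    have "nat \<bar>f a\<bar> - 1 \<in> A"
    proof -
      have "\<bar>a\<bar> \<in> {1..int m}" using that by (auto simp: signed_set_def)
      moreover have "\<bar>f \<bar>a\<bar>\<bar> = \<bar>f a\<bar>" using f' that by (auto simp: FI_BC_hom_def abs_if)
      ultimately show ?thesis unfolding A_def by (metis (mono_tags, lifting) image_eqI)
    qed
    then have "nat \<bar>f a\<bar> - 1 \<in> set xs" using B fin by (auto simp: xs_def)
    then obtain i where i: "i < Suc m" "xs ! i = nat \<bar>f a\<bar> - 1"
      using xs by (auto simp: in_set_conv_nth increasing_lists_def)
    define z where "z = sgn (f a) * (int i + 1)"
    have "f a \<noteq> 0" "1 \<le> \<bar>f a\<bar>" using fa[OF that] by (auto simp: signed_set_def)
    then have az: "\<bar>z\<bar> = int i + 1" and sz: "sgn z = sgn (f a)"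
      by (auto simp: z_def abs_mult sgn_mult)
    have "z \<in> signed_set (Suc m)" using az i by (simp add: signed_set_def)
    moreover have "increasing_hom (Suc m) xs z = f a"
      using calculation az sz i \<open>1 \<le> \<bar>f a\<bar>\<close>
      by (simp add: increasing_hom_def nat_add_distrib of_nat_diff mult_sgn_abs)
    ultimately show ?thesis by (metis image_eqI)
  qed
  then have "\<exists>h\<in>FI_hom W m (Suc m). f = compose (signed_set m) (increasing_hom (Suc m) xs) h"
    by (intro FI_hom_factor_through[OF f increasing_hom_in_FI_A_hom[OF xs]]) (use False in auto)
  with xs show ?thesis by (intro bexI[of _ "Suc m"] bexI[of _ xs]) simp_all
qed

section \<open>Linear algebra: dimension as a count of standard generators\<close>

context vector_space
begin

text \<open>
  Running through the vectors in increasing order and keeping those that enlarge the span so far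
  yields a basis. The index set is ordered, not the vectors, so repetitions do no harm.
\<close>

lemma dim_span_image_eq_card_standard:
  fixes v :: "'i::linorder \<Rightarrow> 'b"
  assumes "finite A"
  shows "dim (span (v ` A)) = card {a \<in> A. v a \<notin> span (v ` {b \<in> A. b < a})}"
proof -
  define std where "std A = {a \<in> A. v a \<notin> span (v ` {b \<in> A. b < a})}" for A
  have "independent (v ` std A) \<and> inj_on v (std A) \<and> span (v ` std A) = span (v ` A)"
    using assms
  proof (induction A rule: finite_linorder_max_induct)
    case empty
    then show ?case by (simp add: std_def independent_empty)
  next
    case (insert b A)
    have below_b: "{c \<in> insert b A. c < b} = A" using insert.hyps(2) by auto
    have below: "{c \<in> insert b A. c < a} = {c \<in> A. c < a}" if "a \<in> A" for a
    proof -
      have "\<not> b < a" using insert.hyps(2) that less_asym by blast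
      then show ?thesis by auto
    qed
    have mem: "a \<in> std (insert b A) \<longleftrightarrow> a \<in> std A" if "a \<in> A" for a
      using below[OF that] that by (simp add: std_def)
    have "b \<in> std (insert b A) \<longleftrightarrow> v b \<notin> span (v ` A)"
      by (simp only: std_def mem_Collect_eq below_b) simp
    moreover have "std (insert b A) \<subseteq> insert b A" "std A \<subseteq> A" by (auto simp: std_def)
    ultimately have std:
      "std (insert b A) = (if v b \<in> span (v ` A) then std A else insert b (std A))"
      using mem insert.hyps(2) by (auto split: if_splits)
    show ?case
    proof (cases "v b \<in> span (v ` A)")
      case True
      then have "span (v ` insert b A) = span (v ` A)" by (simp add: span_redundant)
      with True insert.IH show ?thesis by (simp add: std)
    next
      case False
      then have nin: "v b \<notin> span (v ` std A)" using insert.IH by simp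
      then have "v b \<notin> v ` std A" using span_base by blast
      moreover have "independent (insert (v b) (v ` std A))"
        using insert.IH nin by (simp add: independent_insert)
      moreover have "span (insert (v b) (v ` std A)) = span (insert (v b) (v ` A))"
        using insert.IH by (simp add: span_insert)
      ultimately show ?thesis using False insert.IH by (auto simp: std)
    qed
  qed
  then have ind: "independent (v ` std A)" and inj: "inj_on v (std A)"
    and span: "span (v ` std A) = span (v ` A)" by auto
  have "dim (span (v ` A)) = card (v ` std A)"
    using dim_span_eq_card_independent[OF ind] by (simp add: span)
  then show ?thesis by (simp add: card_image[OF inj]) (simp add: std_def)
qed

end

section \<open>Standard monomials of a finitely generated module\<close>

lemma map_less_map_iff_strict_mono:
  fixes xs ys :: "nat list" and h :: "nat \<Rightarrow> nat"
  assumes "strict_mono h"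
  shows "map h xs < map h ys \<longleftrightarrow> xs < ys"
proof (induction xs arbitrary: ys)
  case Nil
  then show ?case by (cases ys) auto
next
  case (Cons x xs)
  then show ?case using assms
    by (cases ys) (auto simp: strict_mono_less strict_mono_eq)
qed

context FI_module
begin

lemma map_span:
  assumes f: "f \<in> FI_hom W m n" and A: "A \<subseteq> V m" and x: "x \<in> span A"
  shows "\<phi> m n f x \<in> span (\<phi> m n f ` A)"
proof -
  have "\<phi> m n f 0 = 0"
    using map_scale[OF f subspace_0[OF subspace_V], of 0] by simp
  then have "subspace {x \<in> V m. \<phi> m n f x \<in> span (\<phi> m n f ` A)}"
    using subspace_V[of m] f
    by (auto simp: subspace_def map_add map_scale span_zero intro: span_add span_scale)
  moreover have "A \<subseteq> {x \<in> V m. \<phi> m n f x \<in> span (\<phi> m n f ` A)}"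
    using A by (auto intro: span_base)
  ultimately show ?thesis using x span_minimal by blast
qed

text \<open>
  The right-hand side is a submodule containing \<open>S\<close>.
\<close>

lemma V_eq_span_images:
  assumes S: "S \<subseteq> Sigma UNIV V" and gen: "\<And>U. submodule U \<Longrightarrow> S \<subseteq> Sigma UNIV U \<Longrightarrow> U = V"
  shows "V n = span {\<phi> m n f x | m x f. (m, x) \<in> S \<and> f \<in> FI_hom W m n}"
proof -
  define X where "X n = {\<phi> m n f x | m x f. (m, x) \<in> S \<and> f \<in> FI_hom W m n}" for n
  have X: "X n \<subseteq> V n" for n using S map_in by (fastforce simp: X_def)
  have "submodule (\<lambda>n. span (X n))"
    unfolding submodule_def
  proof (intro conjI allI ballI)
    fix n show "subspace (span (X n))" by (rule subspace_span)
    show "span (X n) \<subseteq> V n" using X subspace_V by (rule span_minimal)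
  next
    fix n n' f x assume f: "f \<in> FI_hom W n n'" and x: "x \<in> span (X n)"
    have "\<phi> n n' f ` X n \<subseteq> X n'"
    proof
      fix y assume "y \<in> \<phi> n n' f ` X n"
      then obtain m z g where z: "(m, z) \<in> S" "g \<in> FI_hom W m n" "y = \<phi> n n' f (\<phi> m n g z)"
        by (auto simp: X_def)
      then have "z \<in> V m" using S by blast
      then have "y = \<phi> m n' (compose (signed_set m) f g) z"
        using map_comp[OF z(2) f] z(3) by simp
      moreover have "compose (signed_set m) f g \<in> FI_hom W m n'"
        using z(2) f by (rule FI_hom_compose)
      ultimately show "y \<in> X n'" using z(1) unfolding X_def by blast
    qed
    then show "\<phi> n n' f x \<in> span (X n')"
      using map_span[OF f X x] span_mono by blast
  qed
  moreover have "S \<subseteq> Sigma UNIV (\<lambda>n. span (X n))"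
  proof -
    have "x \<in> X m" if mx: "(m, x) \<in> S" for m x
    proof -
      have "\<phi> m m (FI_id m) x \<in> X m"
        using mx FI_id_in_FI_hom[of m W] unfolding X_def by blast
      moreover have "\<phi> m m (FI_id m) x = x" using S mx by (intro map_id) blast
      ultimately show ?thesis by simp
    qed
    then show ?thesis by (auto intro: span_base)
  qed
  ultimately have "(\<lambda>n. span (X n)) = V" by (rule gen)
  then have "span (X n) = V n" by (rule fun_cong)
  then show ?thesis by (simp add: X_def)
qed

lemma finitely_generated_increasing:
  assumes finitely_generated
  shows "\<exists>ts. (\<forall>(d, y) \<in> set ts. y \<in> V d) \<and>
    (\<forall>n. V n = span {\<phi> d n (increasing_hom d xs) y | d y xs.
      (d, y) \<in> set ts \<and> xs \<in> increasing_lists d n})"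
proof -
  obtain S where S: "finite S" "S \<subseteq> Sigma UNIV V"
    and gen: "\<And>U. submodule U \<Longrightarrow> S \<subseteq> Sigma UNIV U \<Longrightarrow> U = V"
    using assms unfolding finitely_generated_def by blast
  define T where "T = (\<Union>(m, x)\<in>S. \<Union>d\<in>{m, Suc m}. (\<lambda>h. (d, \<phi> m d h x)) ` FI_hom W m d)"
  have "finite T" using S(1) finite_FI_hom by (auto simp: T_def)
  then obtain ts where ts: "set ts = T" using finite_list by blast
  have T: "y \<in> V d" if "(d, y) \<in> T" for d y
    using that S(2) map_in by (fastforce simp: T_def)
  have "V n = span {\<phi> d n (increasing_hom d xs) y | d y xs.
      (d, y) \<in> T \<and> xs \<in> increasing_lists d n}" (is "_ = span ?Y") for n
  proof
    have "?Y \<subseteq> V n" using T map_in increasing_hom_in_FI_hom by blast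
    then show "span ?Y \<subseteq> V n" using subspace_V by (rule span_minimal)
    have "{\<phi> m n f x | m x f. (m, x) \<in> S \<and> f \<in> FI_hom W m n} \<subseteq> ?Y"
    proof clarify
      fix m x f assume mx: "(m, x) \<in> S" and f: "f \<in> FI_hom W m n"
      obtain d xs h where d: "d \<in> {m, Suc m}" and xs: "xs \<in> increasing_lists d n"
        and h: "h \<in> FI_hom W m d" and eq: "f = compose (signed_set m) (increasing_hom d xs) h"
        using FI_hom_factor_increasing[OF f] by (elim bexE)
      have "x \<in> V m" using mx S(2) by blast
      then have "\<phi> m n f x = \<phi> d n (increasing_hom d xs) (\<phi> m d h x)"
        unfolding eq using map_comp[OF h increasing_hom_in_FI_hom[OF xs]] by simp
      moreover have "(d, \<phi> m d h x) \<in> T" unfolding T_def using mx d h by blast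
      ultimately show "\<exists>d y xs. \<phi> m n f x = \<phi> d n (increasing_hom d xs) y \<and>
          (d, y) \<in> T \<and> xs \<in> increasing_lists d n"
        using xs by blast
    qed
    moreover have "V n = span {\<phi> m n f x | m x f. (m, x) \<in> S \<and> f \<in> FI_hom W m n}"
      by (rule V_eq_span_images[OF S(2)]) (rule gen)
    ultimately show "V n \<subseteq> span ?Y" using span_mono by simp
  qed
  then show ?thesis using T ts by (intro exI[of _ ts]) auto
qed

text \<open>
  The monomial \<open>i # xs\<close> stands for the image of the \<open>i\<close>-th generator under the order-preserving
  injection with values \<open>xs\<close>. With this encoding the lexicographic order on lists compares the
  generators first and then the injections.
\<close>

definition monomials :: "(nat \<times> 'v) list \<Rightarrow> nat \<Rightarrow> nat list set" where
  "monomials ts n = (\<Union>i<length ts. (#) i ` increasing_lists (fst (ts ! i)) n)"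

definition monomial_value :: "(nat \<times> 'v) list \<Rightarrow> nat \<Rightarrow> nat list \<Rightarrow> 'v" where
  "monomial_value ts n a = (let (d, y) = ts ! hd a in \<phi> d n (increasing_hom d (tl a)) y)"

definition standard_monomials :: "(nat \<times> 'v) list \<Rightarrow> nat \<Rightarrow> nat list set" where
  "standard_monomials ts n = {a \<in> monomials ts n.
    monomial_value ts n a \<notin> span (monomial_value ts n ` {b \<in> monomials ts n. b < a})}"

lemma finite_monomials: "finite (monomials ts n)"
  by (simp add: monomials_def finite_increasing_lists)

lemma Cons_mem_monomials:
  "i # xs \<in> monomials ts n \<longleftrightarrow> i < length ts \<and> xs \<in> increasing_lists (fst (ts ! i)) n"
  by (auto simp: monomials_def)

lemma monomial_value_image:
  "monomial_value ts n ` monomials ts n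
    = {\<phi> d n (increasing_hom d xs) y | d y xs. (d, y) \<in> set ts \<and> xs \<in> increasing_lists d n}"
  (is "?L = ?R")
proof
  show "?L \<subseteq> ?R"
  proof
    fix z assume "z \<in> ?L"
    then obtain i xs where "i < length ts" "xs \<in> increasing_lists (fst (ts ! i)) n"
      "z = monomial_value ts n (i # xs)" by (auto simp: monomials_def)
    then have "(fst (ts ! i), snd (ts ! i)) \<in> set ts"
      "z = \<phi> (fst (ts ! i)) n (increasing_hom (fst (ts ! i)) xs) (snd (ts ! i))"
      by (simp_all add: monomial_value_def case_prod_beta)
    then show "z \<in> ?R" using \<open>xs \<in> _\<close> by blast
  qed
  show "?R \<subseteq> ?L"
  proof clarify
    fix d y xs assume "(d, y) \<in> set ts" and xs: "xs \<in> increasing_lists d n"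
    then obtain i where i: "i < length ts" "ts ! i = (d, y)" by (auto simp: in_set_conv_nth)
    then have "i # xs \<in> monomials ts n" using xs by (simp add: Cons_mem_monomials)
    moreover have "monomial_value ts n (i # xs) = \<phi> d n (increasing_hom d xs) y"
      using i by (simp add: monomial_value_def)
    ultimately show "\<phi> d n (increasing_hom d xs) y \<in> ?L" by (metis image_eqI)
  qed
qed

lemma monomial_value_in:
  assumes "\<forall>(d, y) \<in> set ts. y \<in> V d" "a \<in> monomials ts n"
  shows "monomial_value ts n a \<in> V n"
proof -
  have "monomial_value ts n a \<in> monomial_value ts n ` monomials ts n" using assms(2) by blast
  then obtain d y xs where "(d, y) \<in> set ts" "xs \<in> increasing_lists d n"
    "monomial_value ts n a = \<phi> d n (increasing_hom d xs) y"
    unfolding monomial_value_image by blast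
  then show ?thesis using assms(1) map_in increasing_hom_in_FI_hom by auto
qed

lemma monomial_value_map:
  assumes ts: "\<forall>(d, y) \<in> set ts. y \<in> V d" and a: "i # xs \<in> monomials ts n"
    and h: "strict_mono h" "\<And>x. x < n \<Longrightarrow> h x < n'"
  shows "\<phi> n n' (increasing_hom n (map h [0..<n])) (monomial_value ts n (i # xs))
    = monomial_value ts n' (i # map h xs)"
proof -
  obtain d y where dy: "ts ! i = (d, y)" by fastforce
  then have i: "(d, y) \<in> set ts" and xs: "xs \<in> increasing_lists d n"
    using a by (auto simp: Cons_mem_monomials in_set_conv_nth)
  have "y \<in> V d" using ts i by blast
  moreover have "map h [0..<n] \<in> increasing_lists n n'"
    using upt_in_increasing_lists h by (rule map_in_increasing_lists)
  ultimately show ?thesis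
    using map_comp[OF increasing_hom_in_FI_hom[OF xs] increasing_hom_in_FI_hom, of "map h [0..<n]" n' y]
    by (simp add: monomial_value_def dy compose_increasing_hom[OF xs])
qed

text \<open>
  If the value at \<open>i # xs\<close> is a combination of values at smaller monomials, apply the morphism
  belonging to \<open>h\<close>: the value at \<open>i # map h xs\<close> is the same combination of values at the images of
  these monomials, and strict monotonicity of \<open>h\<close> keeps them smaller.
\<close>

lemma standard_monomials_pullback:
  assumes ts: "\<forall>(d, y) \<in> set ts. y \<in> V d" and a: "i # xs \<in> monomials ts n"
    and h: "strict_mono h" "\<And>x. x < n \<Longrightarrow> h x < n'"
    and std: "i # map h xs \<in> standard_monomials ts n'"
  shows "i # xs \<in> standard_monomials ts n"
proof (rule ccontr)
  define f where "f = increasing_hom n (map h [0..<n])"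
  define B where "B = {b \<in> monomials ts n. b < i # xs}"
  have f: "f \<in> FI_hom W n n'" unfolding f_def
    by (intro increasing_hom_in_FI_hom map_in_increasing_lists[OF upt_in_increasing_lists] h)
  assume "\<not> ?thesis"
  then have "monomial_value ts n (i # xs) \<in> span (monomial_value ts n ` B)"
    using a by (simp add: standard_monomials_def B_def)
  then have "\<phi> n n' f (monomial_value ts n (i # xs)) \<in> span (\<phi> n n' f ` monomial_value ts n ` B)"
    using monomial_value_in[OF ts] by (intro map_span[OF f]) (auto simp: B_def)
  moreover have "\<phi> n n' f ` monomial_value ts n ` B
      \<subseteq> monomial_value ts n' ` {b \<in> monomials ts n'. b < i # map h xs}"
  proof clarify
    fix b assume "b \<in> B"
    then obtain j ys where b: "b = j # ys" and mem: "j # ys \<in> monomials ts n"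
      and less: "j # ys < i # xs"
      by (cases b) (auto simp: B_def monomials_def)
    have "map h ys \<in> increasing_lists (fst (ts ! j)) n'"
      by (rule map_in_increasing_lists[where n = n])
        (use mem h in \<open>auto simp: Cons_mem_monomials\<close>)
    then have "j # map h ys \<in> monomials ts n'" using mem by (simp add: Cons_mem_monomials)
    moreover have "j # map h ys < i # map h xs"
      using less by (auto simp: map_less_map_iff_strict_mono[OF h(1)])
    moreover have "\<phi> n n' f (monomial_value ts n b) = monomial_value ts n' (j # map h ys)"
      unfolding f_def b by (rule monomial_value_map[OF ts mem h])
    ultimately show "\<phi> n n' f (monomial_value ts n b)
        \<in> monomial_value ts n' ` {b \<in> monomials ts n'. b < i # map h xs}" by blast
  qed
  ultimately have "\<phi> n n' f (monomial_value ts n (i # xs))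
      \<in> span (monomial_value ts n' ` {b \<in> monomials ts n'. b < i # map h xs})"
    by (meson span_mono subsetD)
  moreover have "\<phi> n n' f (monomial_value ts n (i # xs)) = monomial_value ts n' (i # map h xs)"
    unfolding f_def by (rule monomial_value_map[OF ts a h])
  ultimately show False using std by (simp add: standard_monomials_def)
qed

text \<open>
  In terms of gaps, the nonstandard monomials belonging to the generator \<open>i\<close> form an up-set \<open>U i\<close> of
  vectors with \<open>d i + 1\<close> entries, and \<open>n\<close> can be read off from such a vector as its sum plus \<open>d i\<close>.
  So the standard ones in degree \<open>n\<close> correspond to the vectors of sum \<open>n - d i\<close> outside \<open>U i\<close>. This holds
  for \<open>n \<ge> d i\<close> only, below which the subtraction of natural numbers is truncated.
\<close>

lemma eventually_polynomial_card_standard_monomials: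
  assumes ts: "\<forall>(d, y) \<in> set ts. y \<in> V d"
  shows "eventually_polynomial (\<lambda>n. card (standard_monomials ts n))"
proof -
  define d where "d i = fst (ts ! i)" for i
  define U where "U i = {a. length a = Suc (d i) \<and>
    i # from_gaps a \<notin> standard_monomials ts (sum_list a + d i)}" for i
  have mem: "i # from_gaps a \<in> monomials ts (sum_list a + d i)"
    if "i < length ts" "length a = Suc (d i)" for i a
    using from_gaps_increasing[OF that(2)] that(1) by (simp add: Cons_mem_monomials d_def)
  have up: "up_closed (U i)" if i: "i < length ts" for i
    unfolding up_closed_def
  proof (intro ballI allI impI)
    fix a b assume a: "a \<in> U i" and ab: "list_all2 (\<le>) a b"
    then have len: "length a = Suc (d i)" "length b = Suc (d i)"
      by (auto simp: U_def dest: list_all2_lengthD)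
    obtain h :: "nat \<Rightarrow> nat" where h: "strict_mono h"
      "\<And>x. x < sum_list a + d i \<Longrightarrow> h x < sum_list b + d i" "map h (from_gaps a) = from_gaps b"
      using gaps_le_imp_strict_mono_map[OF ab len(1)] by blast
    show "b \<in> U i"
      using standard_monomials_pullback[OF ts mem[OF i len(1)] h(1,2)] a len(2)
      by (auto simp: U_def h(3))
  qed
  have "eventually_polynomial (\<lambda>n. card (compositions (Suc (d i)) n - U i))" if "i < length ts" for i
    by (rule eventually_polynomial_compositions_diff[OF up[OF that]]) (simp add: U_def)
  then have "eventually_polynomial (\<lambda>n. \<Sum>i<length ts. card (compositions (Suc (d i)) (n - d i) - U i))"
    by (intro eventually_polynomial_sum eventually_polynomial_shift[of "\<lambda>n. card (compositions _ n - _)"]) auto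
  moreover have card_eq: "card (standard_monomials ts n)
      = (\<Sum>i<length ts. card (compositions (Suc (d i)) (n - d i) - U i))"
    if n: "\<And>i. i < length ts \<Longrightarrow> d i \<le> n" for n
  proof -
    have "standard_monomials ts n
        = (\<Union>i<length ts. (\<lambda>a. i # from_gaps a) ` (compositions (Suc (d i)) (n - d i) - U i))"
      (is "_ = ?R")
    proof
      show "standard_monomials ts n \<subseteq> ?R"
      proof
        fix b assume b: "b \<in> standard_monomials ts n"
        then obtain i xs where i: "i < length ts" "b = i # xs" "xs \<in> increasing_lists (d i) n"
          by (auto simp: standard_monomials_def monomials_def d_def)
        then obtain a where "length a = Suc (d i)" "sum_list a + d i = n" "from_gaps a = xs"
          using from_gaps_surj by blast
        with b i show "b \<in> ?R" by (force simp: compositions_def U_def)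
      qed
      show "?R \<subseteq> standard_monomials ts n"
        using n by (auto simp: compositions_def U_def)
    qed
    also have "card \<dots> = (\<Sum>i<length ts. card ((\<lambda>a. i # from_gaps a) ` (compositions (Suc (d i)) (n - d i) - U i)))"
      by (rule card_UN_disjoint) (auto simp: finite_compositions)
    also have "\<dots> = (\<Sum>i<length ts. card (compositions (Suc (d i)) (n - d i) - U i))"
      by (intro sum.cong refl card_image)
        (auto simp: inj_on_def compositions_def intro: from_gaps_inj)
    finally show ?thesis .
  qed
  then have "\<forall>\<^sub>F n in sequentially. card (standard_monomials ts n)
      = (\<Sum>i<length ts. card (compositions (Suc (d i)) (n - d i) - U i))"
    unfolding eventually_sequentially
  proof (intro exI allI impI)
    fix n assume n: "(\<Sum>i<length ts. d i) \<le> n"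
    have "d i \<le> n" if "i < length ts" for i
      using member_le_sum[of i "{..<length ts}" d] that n by simp
    then show "card (standard_monomials ts n)
        = (\<Sum>i<length ts. card (compositions (Suc (d i)) (n - d i) - U i))" by (rule card_eq)
  qed
  ultimately show ?thesis by (rule eventually_polynomial_cong)
qed

lemma dim_eventually_polynomial:
  assumes finitely_generated
  shows "(\<exists>B. finite B \<and> span B = V n) \<and> eventually_polynomial (\<lambda>n. dim (V n))"
proof -
  obtain ts where ts: "\<forall>(d, y) \<in> set ts. y \<in> V d"
    and V: "\<And>n. V n = span {\<phi> d n (increasing_hom d xs) y | d y xs.
      (d, y) \<in> set ts \<and> xs \<in> increasing_lists d n}"
    using finitely_generated_increasing[OF assms] by blast
  have eq: "V n = span (monomial_value ts n ` monomials ts n)" for n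
    unfolding monomial_value_image by (rule V)
  have "dim (V n) = card (standard_monomials ts n)" for n
    unfolding eq standard_monomials_def by (rule dim_span_image_eq_card_standard[OF finite_monomials])
  then have "eventually_polynomial (\<lambda>n. dim (V n))"
    using eventually_polynomial_card_standard_monomials[OF ts] by simp
  then show ?thesis using eq finite_monomials by (metis finite_imageI)
qed

end

section \<open>Dimensions of finitely generated modules\<close>

theorem theorem4p20:
  fixes scale :: "'k::field \<Rightarrow> 'v::ab_group_add \<Rightarrow> 'v"
    and W :: weyl_type
    and V :: "nat \<Rightarrow> 'v set"
    and \<phi> :: "nat \<Rightarrow> nat \<Rightarrow> (int \<Rightarrow> int) \<Rightarrow> 'v \<Rightarrow> 'v"
  assumes "FI_module scale W V \<phi>"
    and "FI_module.finitely_generated scale W V \<phi>"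
  shows "\<exists>P :: rat poly. (\<forall>z::int. poly P (of_int z) \<in> \<int>) \<and>
    (\<exists>N. \<forall>n\<ge>N. (\<exists>B. finite B \<and> module.span scale B = V n) \<and>
       of_nat (vector_space.dim scale (V n)) = poly P (of_nat n))"
proof -
  note dim = FI_module.dim_eventually_polynomial[OF assms]
  obtain P :: "rat poly" and N
    where N: "\<And>n. n \<ge> N \<Longrightarrow> of_nat (vector_space.dim scale (V n)) = poly P (of_nat n)"
    using dim unfolding eventually_polynomial_def eventually_sequentially by blast
  have "poly P (of_nat n) \<in> \<int>" if "n \<ge> N" for n
    using N[OF that] by (metis Ints_of_nat)
  then have "poly P (of_int z) \<in> \<int>" for z :: int
    by (rule poly_integer_valued_if_eventually)
  then show ?thesis using N dim by blast
qed

end
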